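(* Let $(X,\mathscr{A},\mu)$ be a probability measure space. Then: (1) if $\mu$ is non-atomic, then $\mu$ is not bounded away from zero; (2) if $\mu$ is bounded away from zero, then $\mu$ is purely atomic.
   Context: A set $A\in\mathscr{A}$ is an atom of $\mu$ if $\mu(A)>0$ and for every $B\in\mathscr{A}$ either $\mu(A\cap B)=0$ or $\mu(A\setminus B)=0$. The measure $\mu$ is non-atomic if it has no atoms, and purely atomic if every $E\in\mathscr{A}$ with $\mu(E)>0$ contains an atom. The measure $\mu$ is bounded away from zero if there exists $\lambda>0$ such that for every $A\in\mathscr{A}$ either $\mu(A)=0$ or $\mu(A)\ge\lambda$. *)

theory Defs
  imports "HOL-Probability.Probability"
begin

definition atom_of :: "'a measure \<Rightarrow> 'a set \<Rightarrow> bool" where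
  "atom_of M A \<longleftrightarrow> A \<in> sets M \<and> emeasure M A > 0 \<and>
     (\<forall>B\<in>sets M. emeasure M (A \<inter> B) = 0 \<or> emeasure M (A - B) = 0)"

definition non_atomic :: "'a measure \<Rightarrow> bool" where
  "non_atomic M \<longleftrightarrow> (\<nexists>A. atom_of M A)"

definition purely_atomic :: "'a measure \<Rightarrow> bool" where
  "purely_atomic M \<longleftrightarrow>
     (\<forall>E\<in>sets M. emeasure M E > 0 \<longrightarrow> (\<exists>A. atom_of M A \<and> A \<subseteq> E))"

(* The bound is a (finite) positive real, also when the measure may take the value infinity. *)
definition bounded_away_from_zero :: "'a measure \<Rightarrow> bool" where
  "bounded_away_from_zero M \<longleftrightarrow>
     (\<exists>c::real. c > 0 \<and> (\<forall>A\<in>sets M. emeasure M A = 0 \<or> emeasure M A \<ge> ennreal c))"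

end

theory Submission
  imports Defs
begin

text \<open>A non-null set that is not an atom splits into two non-null pieces, each of measure at
  least the bound \<open>c\<close>. Passing to one piece loses at least \<open>c\<close>, which a
  finite measure allows only finitely often, so the descent ends in an atom. The second claim yields
  the first by contraposition.\<close>

lemma (in finite_measure) bounded_away_from_zero_imp_purely_atomic:
  assumes "bounded_away_from_zero M"
  shows "purely_atomic M"
proof -
  obtain c :: real where c: "c > 0"
    and bound: "\<And>A. A \<in> sets M \<Longrightarrow> emeasure M A \<noteq> 0 \<Longrightarrow> ennreal c \<le> emeasure M A"
    using assms unfolding bounded_away_from_zero_def by blast
  \<comment> \<open>The induction runs on \<open>n\<close>, which bounds the measure of
    \<open>E\<close> in units of \<open>c\<close>; for \<open>n = 0\<close> the bound is
    absurd.\<close>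
  have contains_atom: "\<exists>A. atom_of M A \<and> A \<subseteq> E"
    if "E \<in> sets M" "emeasure M E > 0" "measure M E < real n * c" for E n
    using that
  proof (induction n arbitrary: E)
    case 0
    then show ?case by (simp add: not_less)
  next
    case (Suc n)
    show ?case
    proof (cases "atom_of M E")
      case False
      then obtain B where B: "B \<in> sets M" "emeasure M (E \<inter> B) \<noteq> 0" "emeasure M (E - B) \<noteq> 0"
        using Suc.prems unfolding atom_of_def by blast
      \<comment> \<open>Discarding \<open>E - B\<close> costs at least \<open>c\<close>, so
        \<open>E \<inter> B\<close> meets the bound for \<open>n\<close>.\<close>
      have "c \<le> measure M (E - B)"
        using bound[of "E - B"] Suc.prems(1) B by (simp add: emeasure_eq_measure)
      moreover have "measure M E = measure M (E \<inter> B) + measure M (E - B)"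
        using finite_measure_Union[of "E \<inter> B" "E - B"] Suc.prems(1) B(1)
        by (simp add: Int_Diff_Un Int_Diff_disjoint)
      ultimately have "measure M (E \<inter> B) < real n * c"
        using Suc.prems(3) by (simp add: algebra_simps)
      with Suc.IH[of "E \<inter> B"] Suc.prems(1) B show ?thesis
        by (auto simp: zero_less_iff_neq_zero)
    qed blast
  qed
  \<comment> \<open>As the measure is finite, every \<open>E\<close> satisfies the bound for some
    \<open>n\<close>.\<close>
  show ?thesis
    unfolding purely_atomic_def
    using contains_atom reals_Archimedean3[OF c] by meson
qed

theorem theorem2p9:
  fixes M :: "'a measure"
  assumes "prob_space M"
  shows "(non_atomic M \<longrightarrow> \<not> bounded_away_from_zero M) \<and>
         (bounded_away_from_zero M \<longrightarrow> purely_atomic M)"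
proof -
  interpret prob_space M by fact
  \<comment> \<open>The whole space has measure 1, so it contains an atom.\<close>
  have "\<not> non_atomic M" if "purely_atomic M"
    using that sets.top[of M] emeasure_space_1
    unfolding purely_atomic_def non_atomic_def by fastforce
  then show ?thesis
    using bounded_away_from_zero_imp_purely_atomic by blast
qed

end
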